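(* Let $m,t\ge1$ be integers and let $|c_l\rangle$, $l=0,\dots,l_o$, be logical states of $m$ bosonic registers, $$|c_l\rangle=\frac1{\sqrt{N_l}}\sum_{i=1}^{N_l}|n^{(l)}_{i1}n^{(l)}_{i2}\cdots n^{(l)}_{im}\rangle,$$ where for each $l$ the rows $(n^{(l)}_{i1},\dots,n^{(l)}_{im})$, $1\le i\le N_l$, are distinct, and all rows of all logical states have the same sum $\sum_jn^{(l)}_{ij}=N_T$. Suppose that for every $s\in\{1,\dots,t\}$ and every $(j_1,\dots,j_s)\in\{1,\dots,m\}^s$ the quantity $$\frac1{N_l}\sum_{i=1}^{N_l}n^{(l)}_{ij_1}n^{(l)}_{ij_2}\cdots n^{(l)}_{ij_s}$$ is independent of $l$. Then for every $\tilde k\in\bigcup_{s\le t}\mathcal K(s)$ the number $\langle c_l|A_{\tilde k}^\dagger A_{\tilde k}|c_l\rangle$ is independent of $l$.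
   Context: Each register has orthonormal number states $|0\rangle,\dots,|N\rangle$ (with $N$ at least every occurring label), and $|n_1\cdots n_m\rangle=|n_1\rangle\otimes\cdots\otimes|n_m\rangle$. For a fixed $0<\gamma<1$, the amplitude damping operators on one register are $$A_k=\sum_{n=k}^{N}\sqrt{\binom nk}\sqrt{(1-\gamma)^{n-k}\gamma^k}\,|n-k\rangle\langle n|,\qquad 0\le k\le N,$$ and for $\tilde k=(k_1,\dots,k_m)\in\{0,\dots,N\}^m$, $A_{\tilde k}=A_{k_1}\otimes\cdots\otimes A_{k_m}$. $\mathcal K(s)$ is the set of $\tilde k$ with $k_1+\cdots+k_m=s$. *)

theory Defs
  imports "Jordan_Normal_Form.Schur_Decomposition"
begin

(* The registers are truncated at level N, so one register is the space of complex
   vectors of dimension N + 1. *)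

definition ket :: "nat \<Rightarrow> nat \<Rightarrow> complex vec" where
  "ket N n = unit_vec (N + 1) n"

definition ket_bra :: "complex vec \<Rightarrow> complex vec \<Rightarrow> complex mat" where
  "ket_bra u v = mat (dim_vec u) (dim_vec v) (\<lambda>(r, c). u $ r * conjugate (v $ c))"

definition damping_op :: "real \<Rightarrow> nat \<Rightarrow> nat \<Rightarrow> complex mat" where
  "damping_op \<gamma> N k = mat (N + 1) (N + 1) (\<lambda>(r, c). \<Sum>n = k..N.
     complex_of_real (sqrt (real (n choose k)) * sqrt ((1 - \<gamma>) ^ (n - k) * \<gamma> ^ k))
       * ket_bra (ket N (n - k)) (ket N n) $$ (r, c))"

(* Kronecker products; the leftmost factor is the most significant digit of the index. *)

definition tensor_vec :: "complex vec \<Rightarrow> complex vec \<Rightarrow> complex vec" where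
  "tensor_vec u v = vec (dim_vec u * dim_vec v)
     (\<lambda>i. u $ (i div dim_vec v) * v $ (i mod dim_vec v))"

definition tensor_mat :: "complex mat \<Rightarrow> complex mat \<Rightarrow> complex mat" where
  "tensor_mat A B = mat (dim_row A * dim_row B) (dim_col A * dim_col B)
     (\<lambda>(r, c). A $$ (r div dim_row B, c div dim_col B) * B $$ (r mod dim_row B, c mod dim_col B))"

definition number_state :: "nat \<Rightarrow> nat list \<Rightarrow> complex vec" where
  "number_state N ns = foldr (\<lambda>n. tensor_vec (ket N n)) ns (unit_vec 1 0)"

definition multi_damping_op :: "real \<Rightarrow> nat \<Rightarrow> nat list \<Rightarrow> complex mat" where
  "multi_damping_op \<gamma> N ks = foldr (\<lambda>k. tensor_mat (damping_op \<gamma> N k)) ks (1\<^sub>m 1)"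

definition damping_indices :: "nat \<Rightarrow> nat \<Rightarrow> nat \<Rightarrow> nat list set" where
  "damping_indices m N s = {ks. length ks = m \<and> set ks \<subseteq> {0..N} \<and> sum_list ks = s}"

definition uniform_state :: "nat \<Rightarrow> nat \<Rightarrow> nat \<Rightarrow> (nat \<Rightarrow> nat list) \<Rightarrow> complex vec" where
  "uniform_state m N M labels = complex_of_real (1 / sqrt (real M)) \<cdot>\<^sub>v
     finsum_vec TYPE(complex) ((N + 1) ^ m) (\<lambda>i. number_state N (labels i)) {1..M}"

definition bra_op_ket :: "complex vec \<Rightarrow> complex mat \<Rightarrow> complex vec \<Rightarrow> complex" where
  "bra_op_ket u A v = conjugate u \<bullet> (A *\<^sub>v v)"

end

(* Each number state is an eigenvector of the adjoint of A_k times A_k, with eigenvalue the product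
   over j of binom(n_j, k_j) (1 - gamma)^(n_j - k_j) gamma^(k_j). Number states are orthonormal, so
   the expectation in a logical state is the mean of this eigenvalue over the rows. Because all rows
   have the same sum, the powers of gamma and 1 - gamma are constant, and what is left is the mean of
   the product of binom(n_j, k_j), a polynomial of degree k_1 + ... + k_m <= t in the n_j. *)

theory Submission
  imports Defs
begin

section \<open>Kronecker products: action on vectors, scalar products and adjoints factor\<close>

text \<open>\<open>i \<mapsto> (i div b, i mod b)\<close> is a bijection from the indices below
  \<open>a * b\<close> to pairs of digits, the encoding used by \<open>tensor_vec\<close> and
  \<open>tensor_mat\<close>. Matrix-vector and scalar products of Kronecker products factor because
  of it.\<close>

lemma sum_mult_div_mod:
  fixes f g :: "nat \<Rightarrow> 'a::semiring_0"
  shows "(\<Sum>i<a * b. f (i div b) * g (i mod b)) = (\<Sum>i<a. f i) * (\<Sum>j<b. g j)"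
proof -
  have "(\<Sum>i<a * b. f (i div b) * g (i mod b)) = (\<Sum>(i, j)\<in>{..<a} \<times> {..<b}. f i * g j)"
  proof (rule sum.reindex_bij_witness[where i = "\<lambda>(i, j). i * b + j" and j = "\<lambda>i. (i div b, i mod b)"])
    fix i assume "i \<in> {..<a * b}"
    then have "i < a * b" by simp
    then have "0 < b" by (cases b) auto
    then show "(i div b, i mod b) \<in> {..<a} \<times> {..<b}"
      using \<open>i < a * b\<close> by (simp add: less_mult_imp_div_less)
  next
    fix p assume "p \<in> {..<a} \<times> {..<b}"
    then obtain i j where p: "p = (i, j)" "i < a" "j < b" by auto
    have "i * b + j < Suc i * b" using p by simp
    also have "\<dots> \<le> a * b" using p by (intro mult_right_mono) auto
    finally show "(case p of (i, j) \<Rightarrow> i * b + j) \<in> {..<a * b}" using p by simp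
  qed (auto simp: split: prod.splits)
  then show ?thesis by (simp add: sum_product sum.cartesian_product)
qed

lemma dim_tensor_vec [simp]: "dim_vec (tensor_vec u v) = dim_vec u * dim_vec v"
  by (simp add: tensor_vec_def)

lemma dim_tensor_mat [simp]:
  "dim_row (tensor_mat A B) = dim_row A * dim_row B"
  "dim_col (tensor_mat A B) = dim_col A * dim_col B"
  by (simp_all add: tensor_mat_def)

lemma div_mod_less_mult:
  fixes i a b :: nat
  assumes "i < a * b"
  shows "i div b < a" "i mod b < b"
proof -
  show "i div b < a" using assms by (simp add: less_mult_imp_div_less)
  show "i mod b < b" using assms by (cases b) auto
qed

lemma index_tensor_vec:
  "i < dim_vec u * dim_vec v \<Longrightarrow> tensor_vec u v $ i = u $ (i div dim_vec v) * v $ (i mod dim_vec v)"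
  by (simp add: tensor_vec_def)

lemma index_tensor_mat:
  "r < dim_row A * dim_row B \<Longrightarrow> c < dim_col A * dim_col B \<Longrightarrow>
   tensor_mat A B $$ (r, c) =
     A $$ (r div dim_row B, c div dim_col B) * B $$ (r mod dim_row B, c mod dim_col B)"
  by (simp add: tensor_mat_def)

lemma tensor_mat_mult_vec:
  assumes "dim_vec u = dim_col A" and "dim_vec v = dim_col B"
  shows "tensor_mat A B *\<^sub>v tensor_vec u v = tensor_vec (A *\<^sub>v u) (B *\<^sub>v v)"
proof (rule eq_vecI)
  fix r assume "r < dim_vec (tensor_vec (A *\<^sub>v u) (B *\<^sub>v v))"
  then have r: "r < dim_row A * dim_row B" by simp
  note rr = div_mod_less_mult[OF r]
  let ?f = "\<lambda>i. A $$ (r div dim_row B, i) * u $ i"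
  let ?g = "\<lambda>j. B $$ (r mod dim_row B, j) * v $ j"
  have "(tensor_mat A B *\<^sub>v tensor_vec u v) $ r
      = (\<Sum>i<dim_col A * dim_col B. ?f (i div dim_col B) * ?g (i mod dim_col B))"
    using r assms
    by (auto simp: scalar_prod_def index_tensor_mat index_tensor_vec lessThan_atLeast0 mult_ac
        intro!: sum.cong)
  also have "\<dots> = (\<Sum>i<dim_col A. ?f i) * (\<Sum>j<dim_col B. ?g j)"
    by (rule sum_mult_div_mod)
  also have "\<dots> = tensor_vec (A *\<^sub>v u) (B *\<^sub>v v) $ r"
    using r rr assms by (simp add: index_tensor_vec scalar_prod_def lessThan_atLeast0)
  finally show "(tensor_mat A B *\<^sub>v tensor_vec u v) $ r = tensor_vec (A *\<^sub>v u) (B *\<^sub>v v) $ r" .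
qed simp

lemma scalar_prod_tensor_vec:
  assumes "dim_vec u = dim_vec u'" and "dim_vec v = dim_vec v'"
  shows "tensor_vec u v \<bullet> tensor_vec u' v' = (u \<bullet> u') * (v \<bullet> v')"
proof -
  let ?f = "\<lambda>i. u $ i * u' $ i" and ?g = "\<lambda>j. v $ j * v' $ j"
  have "tensor_vec u v \<bullet> tensor_vec u' v'
      = (\<Sum>i<dim_vec u' * dim_vec v'. ?f (i div dim_vec v') * ?g (i mod dim_vec v'))"
    using assms
    by (auto simp: scalar_prod_def index_tensor_vec lessThan_atLeast0 mult_ac intro!: sum.cong)
  also have "\<dots> = (\<Sum>i<dim_vec u'. ?f i) * (\<Sum>j<dim_vec v'. ?g j)"
    by (rule sum_mult_div_mod)
  finally show ?thesis
    by (simp add: scalar_prod_def lessThan_atLeast0)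
qed

lemma dim_mat_adjoint [simp]:
  "dim_row (mat_adjoint A) = dim_col A" "dim_col (mat_adjoint A) = dim_row A"
  by (simp_all add: mat_adjoint_def)

lemma index_mat_adjoint:
  "i < dim_col A \<Longrightarrow> j < dim_row A \<Longrightarrow> mat_adjoint A $$ (i, j) = conjugate (A $$ (j, i))"
  by (simp add: mat_adjoint_def mat_of_rows_def)

lemma mat_adjoint_tensor_mat:
  "mat_adjoint (tensor_mat A B) = tensor_mat (mat_adjoint A) (mat_adjoint B)"
  by (rule eq_matI) (auto simp: index_mat_adjoint index_tensor_mat div_mod_less_mult)

lemma tensor_vec_smult:
  "tensor_vec (a \<cdot>\<^sub>v u) (b \<cdot>\<^sub>v v) = (a * b) \<cdot>\<^sub>v tensor_vec u v"
  by (rule eq_vecI) (auto simp: index_tensor_vec div_mod_less_mult)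

section \<open>The damping operator on a single register\<close>

text \<open>For \<open>n < k\<close> the subtraction truncates, but the binomial coefficient vanishes.\<close>

definition damping_weight :: "real \<Rightarrow> nat \<Rightarrow> nat \<Rightarrow> real" where
  "damping_weight \<gamma> k n = real (n choose k) * ((1 - \<gamma>) ^ (n - k) * \<gamma> ^ k)"

lemma dim_damping_op [simp]:
  "dim_row (damping_op \<gamma> N k) = N + 1" "dim_col (damping_op \<gamma> N k) = N + 1"
  by (simp_all add: damping_op_def)

lemma dim_ket [simp]: "dim_vec (ket N n) = N + 1"
  by (simp add: ket_def)

lemma index_ket: "i \<le> N \<Longrightarrow> ket N n $ i = (if i = n then 1 else 0)"
  by (simp add: ket_def unit_vec_def)

lemma index_damping_op:
  assumes "0 < \<gamma>" "\<gamma> < 1" "r \<le> N" "c \<le> N"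
  shows "damping_op \<gamma> N k $$ (r, c) =
    (if c = r + k then complex_of_real (sqrt (damping_weight \<gamma> k c)) else 0)"
proof -
  have "damping_op \<gamma> N k $$ (r, c) = (\<Sum>n = k..N.
      complex_of_real (sqrt (real (n choose k)) * sqrt ((1 - \<gamma>) ^ (n - k) * \<gamma> ^ k))
        * ket_bra (ket N (n - k)) (ket N n) $$ (r, c))"
    using assms by (simp add: damping_op_def)
  also have "\<dots> = (\<Sum>n = k..N. if n = c then
      (if c = r + k then complex_of_real (sqrt (damping_weight \<gamma> k c)) else 0) else 0)"
    using assms
    by (intro sum.cong refl) (auto simp: ket_bra_def index_ket damping_weight_def real_sqrt_mult)
  \<comment> \<open>For \<open>k \<le> c\<close> the sum picks out \<open>n = c\<close>; for
    \<open>c < k\<close> that index is out of range, but then \<open>c = r + k\<close> fails as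
    well.\<close>
  also have "\<dots> = (if c = r + k then complex_of_real (sqrt (damping_weight \<gamma> k c)) else 0)"
    using assms by auto
  finally show ?thesis .
qed

text \<open>The operator lowers the number state \<open>n\<close> to a multiple of
  \<open>n - k\<close>, and its adjoint raises it back with the same real coefficient, so the square
  root in the coefficient is squared away.\<close>

lemma damping_op_adjoint_mult_ket:
  assumes "0 < \<gamma>" "\<gamma> < 1" "n \<le> N"
  shows "mat_adjoint (damping_op \<gamma> N k) *\<^sub>v (damping_op \<gamma> N k *\<^sub>v ket N n)
    = complex_of_real (damping_weight \<gamma> k n) \<cdot>\<^sub>v ket N n"
proof (rule eq_vecI)
  let ?A = "damping_op \<gamma> N k"
  have A: "(?A *\<^sub>v ket N n) $ r = ?A $$ (r, n)" if "r \<le> N" for r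
    using that assms by (simp add: ket_def)
  fix i assume "i < dim_vec (complex_of_real (damping_weight \<gamma> k n) \<cdot>\<^sub>v ket N n)"
  then have i: "i \<le> N" by simp
  \<comment> \<open>Nonnegativity is what makes the product of the two square roots equal to the
    weight.\<close>
  have w: "0 \<le> damping_weight \<gamma> k n" using assms by (simp add: damping_weight_def)
  have "(mat_adjoint ?A *\<^sub>v (?A *\<^sub>v ket N n)) $ i
      = (\<Sum>r\<in>{..N}. mat_adjoint ?A $$ (i, r) * (?A *\<^sub>v ket N n) $ r)"
    using i by (subst index_mult_mat_vec)
      (auto simp: scalar_prod_def atLeast0LessThan lessThan_Suc_atMost
        simp del: index_mult_mat_vec sum.op_ivl_Suc intro!: sum.cong)
  also have "\<dots> = (\<Sum>r\<in>{..N}. conjugate (?A $$ (r, i)) * ?A $$ (r, n))"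
    using i by (intro sum.cong) (auto simp: index_mat_adjoint A simp del: index_mult_mat_vec)
  \<comment> \<open>The two entries require \<open>i = r + k\<close> and \<open>n = r + k\<close>,
    so only \<open>r = n - k\<close> can contribute, and only for \<open>i = n\<close>. If
    \<open>n < k\<close>, the truncated \<open>n - k\<close> is 0, hence the guard
    \<open>k \<le> n\<close>.\<close>
  also have "\<dots> = (\<Sum>r\<in>{..N}. if r = n - k then
      (if i = n \<and> k \<le> n then complex_of_real (damping_weight \<gamma> k n) else 0) else 0)"
    using i assms w
    by (intro sum.cong refl) (auto simp: index_damping_op simp flip: of_real_mult)
  also have "\<dots> = (complex_of_real (damping_weight \<gamma> k n) \<cdot>\<^sub>v ket N n) $ i"
    using i assms by (auto simp: ket_def damping_weight_def)
  finally show "(mat_adjoint ?A *\<^sub>v (?A *\<^sub>v ket N n)) $ i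
    = (complex_of_real (damping_weight \<gamma> k n) \<cdot>\<^sub>v ket N n) $ i" .
qed simp

section \<open>Several registers: eigenvalues and orthonormality of number states\<close>

lemma dim_multi_damping_op [simp]:
  "dim_row (multi_damping_op \<gamma> N ks) = (N + 1) ^ length ks"
  "dim_col (multi_damping_op \<gamma> N ks) = (N + 1) ^ length ks"
  by (induction ks) (simp_all add: multi_damping_op_def)

lemma dim_number_state [simp]: "dim_vec (number_state N ns) = (N + 1) ^ length ns"
  by (induction ns) (simp_all add: number_state_def)

lemma number_state_simps:
  "number_state N [] = unit_vec 1 0"
  "number_state N (n # ns) = tensor_vec (ket N n) (number_state N ns)"
  by (simp_all add: number_state_def)

lemma multi_damping_op_simps:
  "multi_damping_op \<gamma> N [] = 1\<^sub>m 1"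
  "multi_damping_op \<gamma> N (k # ks) = tensor_mat (damping_op \<gamma> N k) (multi_damping_op \<gamma> N ks)"
  by (simp_all add: multi_damping_op_def)

lemma multi_damping_op_adjoint_mult_number_state:
  assumes "0 < \<gamma>" "\<gamma> < 1"
  shows "length ks = length ns \<Longrightarrow> set ns \<subseteq> {0..N} \<Longrightarrow>
    mat_adjoint (multi_damping_op \<gamma> N ks) *\<^sub>v (multi_damping_op \<gamma> N ks *\<^sub>v number_state N ns)
    = complex_of_real (\<Prod>j<length ks. damping_weight \<gamma> (ks ! j) (ns ! j)) \<cdot>\<^sub>v number_state N ns"
proof (induction ks ns rule: list_induct2)
  case Nil
  have "mat_adjoint (1\<^sub>m 1 :: complex mat) = 1\<^sub>m 1"
    by (rule eq_matI) (auto simp: index_mat_adjoint)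
  then show ?case by (simp add: multi_damping_op_simps number_state_simps)
next
  case (Cons k ks n ns)
  then show ?case
    using assms
    \<comment> \<open>The product is split at index 0, which belongs to the heads of the two lists;
      the default rule would split off the last index.\<close>
    by (simp add: multi_damping_op_simps number_state_simps mat_adjoint_tensor_mat
        tensor_mat_mult_vec damping_op_adjoint_mult_ket tensor_vec_smult prod.lessThan_Suc_shift
        del: prod.lessThan_Suc of_real_prod)
qed

lemma scalar_prod_number_state:
  "length ns = length ns' \<Longrightarrow> set ns \<subseteq> {0..N} \<Longrightarrow> set ns' \<subseteq> {0..N} \<Longrightarrow>
    number_state N ns \<bullet> number_state N ns' = (if ns = ns' then 1 else 0)"
proof (induction ns ns' rule: list_induct2)
  case Nil
  then show ?case by (simp add: number_state_simps)
next
  case (Cons n ns n' ns')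
  then show ?case
    by (auto simp: number_state_simps scalar_prod_tensor_vec ket_def)
qed

text \<open>The entries are 0 or 1. This lets the bilinear scalar product stand in for the Hermitian
  one.\<close>

lemma conjugate_number_state: "conjugate (number_state N ns) = number_state N ns"
proof (induction ns)
  case Nil
  then show ?case by (auto simp: number_state_simps)
next
  case (Cons n ns)
  have tail: "conjugate (number_state N ns $ j) = number_state N ns $ j"
    if "j < (N + 1) ^ length ns" for j
    using Cons that by (metis dim_number_state vec_index_conjugate)
  show ?case
  proof (rule eq_vecI)
    fix i assume "i < dim_vec (number_state N (n # ns))"
    then have i: "i < (N + 1) * (N + 1) ^ length ns" by simp
    from div_mod_less_mult[OF i] i
    show "conjugate (number_state N (n # ns)) $ i = number_state N (n # ns) $ i"
      by (simp add: number_state_simps index_tensor_vec conjugate_dist_mul tail[simplified] index_ket)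
  qed simp
qed

section \<open>Expectation values in a logical state\<close>

text \<open>Expanding bra and ket gives a double sum over rows. Orthonormality and distinctness of
  the rows leave the diagonal, and the two normalization factors multiply to
  \<open>1 / real M\<close>.\<close>

lemma bra_op_ket_uniform_state:
  assumes A: "A \<in> carrier_mat ((N + 1) ^ m) ((N + 1) ^ m)" and "1 \<le> M"
    and len: "\<And>i. i \<in> {1..M} \<Longrightarrow> length (L i) = m"
    and set: "\<And>i. i \<in> {1..M} \<Longrightarrow> set (L i) \<subseteq> {0..N}"
    and inj: "inj_on L {1..M}"
    and eig: "\<And>i. i \<in> {1..M} \<Longrightarrow> A *\<^sub>v number_state N (L i) = complex_of_real (w i) \<cdot>\<^sub>v number_state N (L i)"
  shows "bra_op_ket (uniform_state m N M L) A (uniform_state m N M L)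
    = complex_of_real (1 / real M * (\<Sum>i = 1..M. w i))"
proof -
  let ?D = "(N + 1) ^ m" and ?c = "complex_of_real (1 / sqrt (real M))"
  let ?x = "\<lambda>i. number_state N (L i)" and ?u = "uniform_state m N M L"
  have carr: "?x \<in> {1..M} \<rightarrow> carrier_vec ?D"
    using len by (auto intro!: carrier_vecI)
  have dim_u: "dim_vec ?u = ?D"
    using finsum_vec_closed[OF carr] by (simp add: uniform_state_def)
  have u: "?u $ r = ?c * (\<Sum>i = 1..M. ?x i $ r)" if "r < ?D" for r
    using that carr finsum_vec_closed[OF carr] by (simp add: uniform_state_def index_finsum_vec)
  \<comment> \<open>Both the normalization and the number states are real, so conjugation changes
    nothing.\<close>
  have cu: "conjugate ?u $ r = ?c * (\<Sum>i = 1..M. ?x i $ r)" if "r < ?D" for r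
  proof -
    have "conjugate (?x i $ r) = ?x i $ r" if "i \<in> {1..M}" for i
      using that len \<open>r < ?D\<close> conjugate_number_state[of N "L i"]
      by (metis dim_number_state vec_index_conjugate)
    then show ?thesis using that dim_u by (simp add: u)
  qed
  have Au: "(A *\<^sub>v ?u) $ r = ?c * (\<Sum>i = 1..M. complex_of_real (w i) * ?x i $ r)" if r: "r < ?D" for r
  proof -
    have "(A *\<^sub>v ?u) $ r = (\<Sum>j<?D. A $$ (r, j) * ?u $ j)"
      using A r dim_u by (auto simp: scalar_prod_def lessThan_atLeast0)
    also have "\<dots> = (\<Sum>j<?D. \<Sum>i = 1..M. ?c * (A $$ (r, j) * ?x i $ j))"
      by (simp add: u sum_distrib_left mult_ac)
    also have "\<dots> = (\<Sum>i = 1..M. ?c * (\<Sum>j<?D. A $$ (r, j) * ?x i $ j))"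
      by (subst sum.swap) (simp add: sum_distrib_left)
    also have "\<dots> = (\<Sum>i = 1..M. ?c * (A *\<^sub>v ?x i) $ r)"
      using A r len by (auto simp: scalar_prod_def lessThan_atLeast0 intro!: sum.cong)
    also have "\<dots> = (\<Sum>i = 1..M. ?c * (complex_of_real (w i) * ?x i $ r))"
      using r len by (intro sum.cong) (auto simp: eig simp del: index_mult_mat_vec)
    finally show ?thesis by (simp add: sum_distrib_left)
  qed
  have "bra_op_ket ?u A ?u = (\<Sum>r<?D. conjugate ?u $ r * (A *\<^sub>v ?u) $ r)"
    using A by (simp add: bra_op_ket_def scalar_prod_def lessThan_atLeast0)
  also have "\<dots> = (\<Sum>r<?D. (?c * (\<Sum>i' = 1..M. ?x i' $ r)) *
      (?c * (\<Sum>i = 1..M. complex_of_real (w i) * ?x i $ r)))"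
    by (intro sum.cong) (simp_all only: cu Au lessThan_iff)
  also have "\<dots> = (\<Sum>r<?D. ?c * ?c * ((\<Sum>i' = 1..M. ?x i' $ r) *
      (\<Sum>i = 1..M. complex_of_real (w i) * ?x i $ r)))"
    by (simp only: mult_ac)
  also have "\<dots> = (\<Sum>r<?D. \<Sum>i'=1..M. \<Sum>i = 1..M. ?c * ?c * (?x i' $ r * (complex_of_real (w i) * ?x i $ r)))"
    by (simp only: sum_product) (simp only: sum_distrib_left)
  \<comment> \<open>The sum over vector entries moves inward past both sums over rows, where it
    becomes a scalar product.\<close>
  also have "\<dots> = (\<Sum>i'=1..M. \<Sum>i = 1..M. \<Sum>r<?D. ?c * ?c * (?x i' $ r * (complex_of_real (w i) * ?x i $ r)))"
    by (subst sum.swap, rule sum.cong[OF refl], rule sum.swap)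
  also have "\<dots> = (\<Sum>i'=1..M. \<Sum>i = 1..M. ?c * ?c * complex_of_real (w i) * (?x i' \<bullet> ?x i))"
    using len by (auto simp: scalar_prod_def lessThan_atLeast0 sum_distrib_left mult_ac intro!: sum.cong)
  \<comment> \<open>Orthonormality only compares the rows \<open>L i'\<close> and
    \<open>L i\<close>; injectivity of \<open>L\<close> turns their equality into
    \<open>i = i'\<close>.\<close>
  also have "\<dots> = (\<Sum>i'=1..M. \<Sum>i = 1..M. if i = i' then ?c * ?c * complex_of_real (w i) else 0)"
    using len set inj
    by (intro sum.cong refl) (auto simp: scalar_prod_number_state dest: inj_onD)
  also have "\<dots> = (\<Sum>i'=1..M. ?c * ?c * complex_of_real (w i'))"
    by simp
  also have "?c * ?c = complex_of_real (1 / real M)"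
    by (simp flip: of_real_mult of_real_divide)
  finally show ?thesis by (simp add: sum_distrib_left)
qed

section \<open>From eigenvalues to binomial coefficients and monomials\<close>

text \<open>If every \<open>ks ! j \<le> ns ! j\<close>, the exponents
  \<open>ns ! j - ks ! j\<close> add up without truncation. Otherwise they need not, but a vanishing
  binomial coefficient makes both sides 0.\<close>

lemma prod_damping_weight:
  assumes "length ks = length ns"
  shows "(\<Prod>j<length ks. damping_weight \<gamma> (ks ! j) (ns ! j))
    = (1 - \<gamma>) ^ (sum_list ns - sum_list ks) * \<gamma> ^ sum_list ks
      * (\<Prod>j<length ks. real (ns ! j choose ks ! j))"
proof (cases "\<forall>j<length ks. ks ! j \<le> ns ! j")
  case True
  have "(\<Sum>j<length ks. ns ! j - ks ! j) = sum_list ns - sum_list ks"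
    using True assms
    by (subst sum_subtractf_nat) (auto simp: sum_list_sum_nth lessThan_atLeast0)
  moreover have "(\<Sum>j<length ks. ks ! j) = sum_list ks"
    by (simp add: sum_list_sum_nth lessThan_atLeast0)
  ultimately show ?thesis
    by (simp add: damping_weight_def prod.distrib flip: power_sum)
next
  case False
  then obtain j where j: "j < length ks" "ns ! j < ks ! j" by (auto simp: not_le)
  then have "(\<Prod>j<length ks. real (ns ! j choose ks ! j)) = 0"
    by (auto intro!: prod_zero)
  moreover have "(\<Prod>j<length ks. damping_weight \<gamma> (ks ! j) (ns ! j)) = 0"
    using j by (auto simp: damping_weight_def intro!: prod_zero)
  ultimately show ?thesis by (simp only: mult_zero_right)
qed

text \<open>This is \<open>(k + 1) (n choose (k + 1)) = (n - k) (n choose k)\<close> with the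
  subtraction in the reals; for \<open>k > n\<close> both sides vanish. The right-hand side has the
  shape that \<open>mean_linear\<close> handles.\<close>

lemma choose_Suc_real:
  "real (n choose Suc k) = (real n * real (n choose k) - real k * real (n choose k)) / real (Suc k)"
proof -
  have "real (Suc k) * real (n choose Suc k) = (real n - real k) * real (n choose k)"
  proof (cases "k \<le> n")
    case True
    then show ?thesis
      using binomial_absorb_comp[of n k] binomial_absorption[of k "n"]
      by (metis (no_types, lifting) Suc_times_binomial_add binomial_eq_0 of_nat_diff of_nat_mult times_binomial_minus1_eq)
  qed (simp add: binomial_eq_0)
  then show ?thesis by (simp add: field_simps)
qed

definition mean :: "nat \<Rightarrow> (nat \<Rightarrow> nat list) \<Rightarrow> (nat list \<Rightarrow> real) \<Rightarrow> real" where
  "mean M L f = 1 / real M * (\<Sum>i = 1..M. f (L i))"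

lemma mean_linear:
  "mean M L (\<lambda>x. (f x - a * g x) / b) = (mean M L f - a * mean M L g) / b"
  by (simp add: mean_def sum_subtractf sum_divide_distrib[symmetric] sum_distrib_left[symmetric] field_simps diff_divide_distrib)

text \<open>Registers may repeat in \<open>js\<close>, so powers are covered and the degree is
  \<open>length js\<close>; the empty list gives the constant 1.\<close>

definition monomial :: "nat list \<Rightarrow> nat list \<Rightarrow> real" where
  "monomial js ns = (\<Prod>j\<leftarrow>js. real (ns ! j))"

text \<open>The extra factor \<open>monomial js\<close> makes the induction go through: the recursion
  \<open>(d + 1) (n choose (d + 1)) = n (n choose d) - d (n choose d)\<close> lowers \<open>d\<close> at the cost of one more
  factor \<open>n\<close> in the monomial.\<close>

lemma mean_prod_choose_eq:
  assumes eq: "\<And>js. set js \<subseteq> {..<m} \<Longrightarrow> length js \<le> t \<Longrightarrow>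
      mean M L (monomial js) = mean M' L' (monomial js)"
  shows "r \<le> m \<Longrightarrow> set js \<subseteq> {..<m} \<Longrightarrow> length js + (\<Sum>j<r. k j) \<le> t \<Longrightarrow>
      mean M L (\<lambda>ns. (\<Prod>j<r. real (ns ! j choose k j)) * monomial js ns)
    = mean M' L' (\<lambda>ns. (\<Prod>j<r. real (ns ! j choose k j)) * monomial js ns)"
proof (induction r arbitrary: js)
  case 0
  then show ?case using eq by simp
next
  case (Suc r)
  let ?P = "\<lambda>ns. \<Prod>j<r. real (ns ! j choose k j)"
  \<comment> \<open>Register \<open>r\<close> is treated by an inner induction on its lower binomial
    index \<open>d\<close>, with \<open>js\<close> again arbitrary. At \<open>d = 0\<close> the
    binomial is 1 and the outer hypothesis for the first \<open>r\<close> registers applies.\<close>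
  have "set js \<subseteq> {..<m} \<Longrightarrow> length js + d + (\<Sum>j<r. k j) \<le> t \<Longrightarrow>
      mean M L (\<lambda>ns. ?P ns * real (ns ! r choose d) * monomial js ns)
    = mean M' L' (\<lambda>ns. ?P ns * real (ns ! r choose d) * monomial js ns)" for d js
  proof (induction d arbitrary: js)
    case 0
    then show ?case using Suc.IH[of js] Suc.prems by simp
  next
    case (Suc d)
    let ?f = "\<lambda>js ns. ?P ns * real (ns ! r choose d) * monomial js ns"
    have "?P ns * real (ns ! r choose Suc d) * monomial js ns
        = (?f (r # js) ns - real d * ?f js ns) / real (Suc d)" for ns
      by (simp add: choose_Suc_real monomial_def algebra_simps diff_divide_distrib del: of_nat_Suc)
    \<comment> \<open>The monomial gains one factor while the binomial index drops from
      \<open>Suc d\<close> to \<open>d\<close>, so the degree bound by \<open>t\<close> is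
      preserved. In the second term the degree even falls by one.\<close>
    moreover have "mean M L (?f (r # js)) = mean M' L' (?f (r # js))"
      using Suc.prems \<open>Suc r \<le> m\<close> by (intro Suc.IH) auto
    moreover have "mean M L (?f js) = mean M' L' (?f js)"
      using Suc.prems by (intro Suc.IH) auto
    ultimately show ?case by (simp only: mean_linear)
  qed
  from this[of js "k r"] show ?case using Suc.prems by (simp add: mult_ac)
qed

section \<open>Independence of the logical state\<close>

text \<open>The common row sum \<open>NT\<close> lets the powers of \<open>\<gamma>\<close> and
  \<open>1 - \<gamma>\<close> be pulled out of the mean, leaving a prefactor that depends on
  \<open>NT\<close> and \<open>ks\<close> but not on the rows.\<close>

lemma bra_op_ket_damping_uniform_state:
  assumes "0 < \<gamma>" "\<gamma> < 1" "1 \<le> M"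
    and len: "\<And>i. i \<in> {1..M} \<Longrightarrow> length (L i) = m"
    and set: "\<And>i. i \<in> {1..M} \<Longrightarrow> set (L i) \<subseteq> {0..N}"
    and inj: "inj_on L {1..M}"
    and total: "\<And>i. i \<in> {1..M} \<Longrightarrow> sum_list (L i) = NT"
    and ks: "length ks = m"
  shows "bra_op_ket (uniform_state m N M L)
      (mat_adjoint (multi_damping_op \<gamma> N ks) * multi_damping_op \<gamma> N ks) (uniform_state m N M L)
    = complex_of_real ((1 - \<gamma>) ^ (NT - sum_list ks) * \<gamma> ^ sum_list ks
        * mean M L (\<lambda>ns. \<Prod>j<m. real (ns ! j choose ks ! j)))"
proof -
  let ?B = "multi_damping_op \<gamma> N ks" and ?D = "(N + 1) ^ m"
  let ?w = "\<lambda>i. \<Prod>j<length ks. damping_weight \<gamma> (ks ! j) (L i ! j)"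
  have B: "?B \<in> carrier_mat ?D ?D" "mat_adjoint ?B \<in> carrier_mat ?D ?D"
    using ks by (auto intro!: carrier_matI)
  have "(mat_adjoint ?B * ?B) *\<^sub>v number_state N (L i) = complex_of_real (?w i) \<cdot>\<^sub>v number_state N (L i)"
    if i: "i \<in> {1..M}" for i
  proof -
    have "number_state N (L i) \<in> carrier_vec ?D"
      using len[OF i] by (intro carrier_vecI) simp
    then have "(mat_adjoint ?B * ?B) *\<^sub>v number_state N (L i) = mat_adjoint ?B *\<^sub>v (?B *\<^sub>v number_state N (L i))"
      using B by (intro assoc_mult_mat_vec)
    then show ?thesis
      using multi_damping_op_adjoint_mult_number_state[OF assms(1,2), of ks "L i" N] len set i ks
      by simp
  qed
  then have "bra_op_ket (uniform_state m N M L) (mat_adjoint ?B * ?B) (uniform_state m N M L)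
      = complex_of_real (1 / real M * (\<Sum>i = 1..M. ?w i))"
    using B assms by (intro bra_op_ket_uniform_state) auto
  also have "(\<Sum>i = 1..M. ?w i) = (\<Sum>i = 1..M. (1 - \<gamma>) ^ (NT - sum_list ks) * \<gamma> ^ sum_list ks
        * (\<Prod>j<m. real (L i ! j choose ks ! j)))"
  proof (intro sum.cong refl)
    fix i assume i: "i \<in> {1..M}"
    show "?w i = (1 - \<gamma>) ^ (NT - sum_list ks) * \<gamma> ^ sum_list ks * (\<Prod>j<m. real (L i ! j choose ks ! j))"
      using prod_damping_weight[of ks "L i" \<gamma>] len[OF i] total[OF i] ks by simp
  qed
  finally show ?thesis
    by (simp add: mean_def sum_distrib_left mult_ac)
qed

theorem theorem6:
  fixes m t lo N NT :: nat
    and \<gamma> :: real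
    and Nl :: "nat \<Rightarrow> nat"
    and labels :: "nat \<Rightarrow> nat \<Rightarrow> nat list"
    and c :: "nat \<Rightarrow> complex vec"
  assumes "1 \<le> m" and "1 \<le> t"
    and "0 < \<gamma>" and "\<gamma> < 1"
    and "\<And>l. l \<le> lo \<Longrightarrow> 1 \<le> Nl l"
    and "\<And>l i. l \<le> lo \<Longrightarrow> i \<in> {1..Nl l} \<Longrightarrow> length (labels l i) = m"
    and "\<And>l i. l \<le> lo \<Longrightarrow> i \<in> {1..Nl l} \<Longrightarrow> set (labels l i) \<subseteq> {0..N}"
    and "\<And>l. l \<le> lo \<Longrightarrow> inj_on (labels l) {1..Nl l}"
    and "\<And>l i. l \<le> lo \<Longrightarrow> i \<in> {1..Nl l} \<Longrightarrow> sum_list (labels l i) = NT"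
    and "\<And>l. l \<le> lo \<Longrightarrow> c l = uniform_state m N (Nl l) (labels l)"
    and "\<And>s js l l'. s \<in> {1..t} \<Longrightarrow> length js = s \<Longrightarrow> set js \<subseteq> {..<m} \<Longrightarrow> l \<le> lo \<Longrightarrow> l' \<le> lo \<Longrightarrow>
           (1 / real (Nl l)) * (\<Sum>i = 1..Nl l. \<Prod>j\<leftarrow>js. real (labels l i ! j))
         = (1 / real (Nl l')) * (\<Sum>i = 1..Nl l'. \<Prod>j\<leftarrow>js. real (labels l' i ! j))"
  shows "\<forall>ks \<in> (\<Union>s\<le>t. damping_indices m N s). \<forall>l\<le>lo. \<forall>l'\<le>lo.
           bra_op_ket (c l) (mat_adjoint (multi_damping_op \<gamma> N ks) * multi_damping_op \<gamma> N ks) (c l)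
         = bra_op_ket (c l') (mat_adjoint (multi_damping_op \<gamma> N ks) * multi_damping_op \<gamma> N ks) (c l')"
proof (intro ballI allI impI)
  fix ks l l'
  assume "ks \<in> (\<Union>s\<le>t. damping_indices m N s)" and l: "l \<le> lo" "l' \<le> lo"
  then have ks: "length ks = m" "sum_list ks \<le> t" by (auto simp: damping_indices_def)
  have mono: "mean (Nl l) (labels l) (monomial js) = mean (Nl l') (labels l') (monomial js)"
    if "set js \<subseteq> {..<m}" "length js \<le> t" for js
  \<comment> \<open>The hypothesis on moments starts at degree 1. The mean of the empty monomial is
    1 for both states because each has at least one row.\<close>
  proof (cases "js = []")
    case True
    then show ?thesis using assms(5)[OF l(1)] assms(5)[OF l(2)] by (simp add: mean_def monomial_def)
  next
    case False
    then have "length js \<in> {1..t}" using that by (cases js) auto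
    from assms(11)[OF this refl that(1) l] show ?thesis by (simp only: mean_def monomial_def)
  qed
  have "(\<Sum>j<m. ks ! j) \<le> t"
    using ks by (simp add: sum_list_sum_nth lessThan_atLeast0)
  \<comment> \<open>All \<open>m\<close> registers are taken with the empty monomial, so the degree
    to be bounded by \<open>t\<close> is just the sum of \<open>ks\<close>.\<close>
  then have "mean (Nl l) (labels l) (\<lambda>ns. \<Prod>j<m. real (ns ! j choose ks ! j))
      = mean (Nl l') (labels l') (\<lambda>ns. \<Prod>j<m. real (ns ! j choose ks ! j))"
    using mean_prod_choose_eq[where r = m and js = "[]" and k = "\<lambda>j. ks ! j", OF mono] by (simp add: monomial_def)
  moreover have "bra_op_ket (c a) (mat_adjoint (multi_damping_op \<gamma> N ks) * multi_damping_op \<gamma> N ks) (c a)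
      = complex_of_real ((1 - \<gamma>) ^ (NT - sum_list ks) * \<gamma> ^ sum_list ks
        * mean (Nl a) (labels a) (\<lambda>ns. \<Prod>j<m. real (ns ! j choose ks ! j)))" if "a \<le> lo" for a
    unfolding assms(10)[OF that]
    by (rule bra_op_ket_damping_uniform_state) (use that ks assms in auto)
  ultimately show "bra_op_ket (c l) (mat_adjoint (multi_damping_op \<gamma> N ks) * multi_damping_op \<gamma> N ks) (c l)
      = bra_op_ket (c l') (mat_adjoint (multi_damping_op \<gamma> N ks) * multi_damping_op \<gamma> N ks) (c l')"
    using l by simp
qed

end
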